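(* Let $p\geq 5$ be a prime, let $\alpha\geq 1$ be an integer, and let $k=p^{2\alpha}$. Then for all integers $n\geq 1$, \[ \mathfrak{B}_k\!\left(p^{2\alpha-1}n+\frac{p^{2\alpha}-1}{12}\right) \equiv 0 \pmod p . \]
   Context: For $|q|<1$ write $(a;q)_\infty=\prod_{j=0}^{\infty}(1-aq^j)$. For an integer $k\geq 3$, $\mathfrak{B}_k(n)$ denotes the number of $k$ dots bracelet partitions of $n$; these integers are determined by the generating function \[ \sum_{n=0}^{\infty}\mathfrak{B}_{k}(n)q^n=\frac{(-q;q)_{\infty}}{(q;q)_{\infty}^{k-1}(-q^k;q^k)_{\infty}} . \] *)

theory Defs
  imports "HOL-Complex_Analysis.Complex_Analysis" "HOL-Number_Theory.Cong"
begin

(* (a;q)_oo; only meaningful for norm q < 1, where the product converges *)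
definition qpoch_inf :: "complex \<Rightarrow> complex \<Rightarrow> complex" where
  "qpoch_inf a q = (\<Prod>j. 1 - a * q ^ j)"

definition bracelet_gf :: "nat \<Rightarrow> complex \<Rightarrow> complex" where
  "bracelet_gf k q =
     qpoch_inf (-q) q / (qpoch_inf q q ^ (k - 1) * qpoch_inf (-(q ^ k)) (q ^ k))"

(* The number of k dots bracelet partitions of n, for k >= 3, as determined by the generating
   function.  Existence and uniqueness of the integer sequence are established below. *)
definition bracelet_partitions :: "nat \<Rightarrow> nat \<Rightarrow> int" where
  "bracelet_partitions k =
     (THE B. \<forall>q. norm q < 1 \<longrightarrow> (\<lambda>n. of_int (B n) * q ^ n) sums bracelet_gf k q)"

(* Holomorphic on the unit disc, with integer Taylor coefficients at 0 *)
definition int_taylor :: "(complex \<Rightarrow> complex) \<Rightarrow> bool" where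
  "int_taylor f \<longleftrightarrow> f holomorphic_on ball 0 1 \<and> (\<forall>n. fps_nth (fps_expansion f 0) n \<in> \<int>)"

lemma int_taylor_expansion:
  assumes "int_taylor f"
  shows "f has_fps_expansion fps_expansion f 0"
  using assms unfolding int_taylor_def by (intro has_fps_expansion_fps_expansion[of "ball 0 1"]) auto

lemma int_taylorI:
  assumes "f holomorphic_on ball 0 1" "f has_fps_expansion F" "\<And>n. fps_nth F n \<in> \<int>"
  shows "int_taylor f"
  using assms fps_expansion_eqI[OF assms(2)] by (simp add: int_taylor_def)

lemma int_taylor_mult:
  assumes "int_taylor f" "int_taylor g"
  shows "int_taylor (\<lambda>z. f z * g z)"
proof (rule int_taylorI)
  show "(\<lambda>z. f z * g z) has_fps_expansion fps_expansion f 0 * fps_expansion g 0"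
    using assms by (intro has_fps_expansion_mult int_taylor_expansion)
  show "fps_nth (fps_expansion f 0 * fps_expansion g 0) n \<in> \<int>" for n
    using assms by (auto simp: fps_mult_nth int_taylor_def intro!: Ints_sum Ints_mult)
qed (use assms in \<open>auto simp: int_taylor_def intro!: holomorphic_intros\<close>)

lemma int_taylor_const: "c \<in> \<int> \<Longrightarrow> int_taylor (\<lambda>_. c)"
  by (rule int_taylorI[where F = "fps_const c"]) auto

lemma int_taylor_prod:
  assumes "finite A" "\<And>i. i \<in> A \<Longrightarrow> int_taylor (f i)"
  shows "int_taylor (\<lambda>z. \<Prod>i\<in>A. f i z)"
  using assms by (induction rule: finite_induct) (auto intro: int_taylor_mult int_taylor_const)

lemma int_taylor_power: "int_taylor f \<Longrightarrow> int_taylor (\<lambda>z. f z ^ n)"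
  by (induction n) (auto intro: int_taylor_mult int_taylor_const)

lemma int_taylor_inverse:
  assumes f: "int_taylor f" and "f 0 = 1" and nz: "\<And>z. norm z < 1 \<Longrightarrow> f z \<noteq> 0"
  shows "int_taylor (\<lambda>z. inverse (f z))"
proof (rule int_taylorI)
  define F where "F = fps_expansion f 0"
  have F: "f has_fps_expansion F"
    unfolding F_def by (rule int_taylor_expansion[OF f])
  have F0: "fps_nth F 0 = 1"
    by (simp add: F_def fps_expansion_def \<open>f 0 = 1\<close>)
  have FZ: "fps_nth F n \<in> \<int>" for n
    using f by (auto simp: int_taylor_def F_def)
  show "(\<lambda>z. inverse (f z)) has_fps_expansion inverse F"
    by (intro has_fps_expansion_inverse F) (simp add: F0)
  show "fps_nth (inverse F) n \<in> \<int>" for n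
  proof (induction n rule: less_induct)
    case (less n)
    show ?case
    proof (cases "n = 0")
      case False
      have "0 = fps_nth (F * inverse F) n"
        using False by (subst inverse_mult_eq_1') (auto simp: F0)
      also have "\<dots> = (\<Sum>i=0..n. fps_nth F i * fps_nth (inverse F) (n - i))"
        by (simp add: fps_mult_nth)
      also have "\<dots> = fps_nth (inverse F) n
          + (\<Sum>i\<in>{1..n}. fps_nth F i * fps_nth (inverse F) (n - i))"
        by (subst sum.atLeast_Suc_atMost) (auto simp: F0)
      finally have "fps_nth (inverse F) n
          = - (\<Sum>i\<in>{1..n}. fps_nth F i * fps_nth (inverse F) (n - i))"
        by (simp add: eq_neg_iff_add_eq_0)
      also have "\<dots> \<in> \<int>"
        by (intro Ints_minus Ints_sum Ints_mult FZ less) (use False in auto)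
      finally show ?thesis .
    qed (simp add: F0)
  qed
  show "(\<lambda>z. inverse (f z)) holomorphic_on ball 0 1"
    using f nz by (auto simp: int_taylor_def intro!: holomorphic_intros)
qed

lemma int_taylor_limit:
  assumes f: "\<And>N. int_taylor (f N)"
    and lim: "\<And>r. 0 < r \<Longrightarrow> r < 1 \<Longrightarrow> uniform_limit (cball 0 r) f g sequentially"
  shows "int_taylor g"
  unfolding int_taylor_def
proof (intro conjI allI)
  show "g holomorphic_on ball 0 1"
  proof (rule holomorphic_uniform_sequence[where f = f])
    fix x :: complex assume x: "x \<in> ball 0 1"
    define d where "d = (1 - norm x) / 2"
    have d: "d > 0" using x by (simp add: d_def)
    have "norm y \<le> norm x + d" if "dist x y \<le> d" for y
      using norm_triangle_ineq[of x "y - x"] that by (simp add: dist_norm norm_minus_commute)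
    then have sub: "cball x d \<subseteq> cball 0 (norm x + d)"
      by auto
    have lt: "norm x + d < 1" using x by (simp add: d_def field_simps)
    have "cball x d \<subseteq> ball 0 1" using sub lt by fastforce
    moreover have "uniform_limit (cball x d) f g sequentially"
      by (rule uniform_limit_on_subset[OF lim sub])
         (use d lt norm_ge_zero[of x] in linarith)+
    ultimately show "\<exists>d>0. cball x d \<subseteq> ball 0 1 \<and> uniform_limit (cball x d) f g sequentially"
      using d by blast
  qed (use f in \<open>auto simp: int_taylor_def\<close>)
next
  fix n
  have lim': "uniform_limit (ball 0 (1/2)) f g sequentially"
    by (rule uniform_limit_on_subset[OF lim[of "1/2"]]) auto
  have "(\<lambda>N. (deriv ^^ n) (f N) 0) \<longlonglongrightarrow> (deriv ^^ n) g 0"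
  proof (rule higher_deriv_complex_uniform_limit[OF lim'])
    show "\<forall>\<^sub>F N in sequentially. f N holomorphic_on ball 0 (1/2)"
    proof (intro always_eventually allI)
      show "f N holomorphic_on ball 0 (1/2)" for N
        using f[of N] unfolding int_taylor_def
        by (auto elim!: holomorphic_on_subset)
    qed
  qed auto
  then have "(\<lambda>N. (deriv ^^ n) (f N) 0 / fact n) \<longlonglongrightarrow> (deriv ^^ n) g 0 / fact n"
    by (intro tendsto_divide) auto
  then have "(deriv ^^ n) g 0 / fact n \<in> \<int>"
    by (rule Lim_in_closed_set[rotated 3])
       (use f in \<open>auto simp: int_taylor_def fps_expansion_def intro!: always_eventually\<close>)
  then show "fps_nth (fps_expansion g 0) n \<in> \<int>"
    by (simp add: fps_expansion_def)
qed

lemma convergent_prod_qpoch: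
  assumes "norm (q :: complex) < 1"
  shows "convergent_prod (\<lambda>j. 1 - a * q ^ j)"
proof (rule abs_convergent_prod_imp_convergent_prod, rule summable_imp_abs_convergent_prod)
  show "summable (\<lambda>j. norm (1 - a * q ^ j - 1))"
    using assms by (simp add: norm_mult norm_power summable_mult summable_geometric)
qed

lemma qpoch_inf_nonzero:
  assumes "norm q < 1" "norm a < 1"
  shows "qpoch_inf a q \<noteq> 0"
proof -
  have "0 \<notin> range (\<lambda>j. 1 - a * q ^ j)"
  proof
    assume "0 \<in> range (\<lambda>j. 1 - a * q ^ j)"
    then obtain j where "0 = 1 - a * q ^ j"
      by (rule imageE)
    then have "1 = norm a * norm q ^ j"
      by (metis eq_iff_diff_eq_0 norm_mult norm_one norm_power)
    also have "\<dots> \<le> norm a * 1"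
      using assms by (intro mult_left_mono power_le_one) auto
    finally show False using assms by simp
  qed
  moreover have "(\<lambda>j. 1 - a * q ^ j) has_prod qpoch_inf a q"
    unfolding qpoch_inf_def
    by (rule convergent_prod_has_prod[OF convergent_prod_qpoch[OF assms(1)]])
  ultimately show ?thesis
    by (simp only: has_prod_eq_0_iff not_False_eq_True)
qed

lemma int_taylor_qpoch:
  assumes c: "c \<in> {1, -1 :: complex}" and m: "m \<ge> 1"
  shows "int_taylor (\<lambda>z. qpoch_inf (c * z ^ m) (z ^ m))"
proof (rule int_taylor_limit)
  define t where "t = (\<lambda>j z. 1 - c * z ^ m * (z ^ m) ^ j)"
  show "int_taylor (\<lambda>z. \<Prod>j<N. t j z)" for N
  proof (rule int_taylor_prod)
    fix j
    have eq: "t j = (\<lambda>z. 1 - c * z ^ (m * Suc j))"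
      by (auto simp: t_def power_add power_mult)
    show "int_taylor (t j)"
    proof (rule int_taylorI)
      show "t j has_fps_expansion 1 - fps_const c * fps_X ^ (m * Suc j)"
        unfolding eq by (intro fps_expansion_intros)
      show "t j holomorphic_on ball 0 1"
        unfolding eq by (intro holomorphic_intros)
      show "fps_nth (1 - fps_const c * fps_X ^ (m * Suc j)) n \<in> \<int>" for n
        using c by (auto simp: fps_X_power_nth)
    qed
  qed auto
  fix r :: real assume r: "0 < r" "r < 1"
  have "uniformly_convergent_on (cball 0 r) (\<lambda>N z. \<Prod>j<N. t j z)"
  proof (rule uniformly_convergent_on_prod')
    show "uniformly_convergent_on (cball 0 r) (\<lambda>N z. \<Sum>j<N. norm (t j z - 1))"
    proof (rule Weierstrass_m_test')
      fix j and z :: complex assume "z \<in> cball 0 r"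
      then have z: "norm z \<le> r" by simp
      have "norm (t j z - 1) = norm z ^ (m * Suc j)"
        using c by (auto simp: t_def norm_mult norm_power power_add power_mult)
      also have "\<dots> \<le> r ^ (m * Suc j)"
        using z by (intro power_mono) auto
      also have "\<dots> \<le> r ^ j"
        using r m by (intro power_decreasing) (auto simp: trans_le_add2)
      finally show "norm (norm (t j z - 1)) \<le> r ^ j" by simp
    qed (use r in \<open>auto intro: summable_geometric\<close>)
  qed (auto simp: t_def intro!: continuous_intros)
  then have "uniform_limit (cball 0 r) (\<lambda>N z. \<Prod>j<N. t j z)
               (\<lambda>z. lim (\<lambda>N. \<Prod>j<N. t j z)) sequentially"
    by (simp add: uniformly_convergent_uniform_limit_iff)
  moreover have "lim (\<lambda>N. \<Prod>j<N. t j z) = qpoch_inf (c * z ^ m) (z ^ m)"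
    if "z \<in> cball 0 r" for z
  proof (rule limI)
    have "norm (z ^ m) < 1"
      using that r m by (auto simp: norm_power intro!: power_less_one_iff[THEN iffD2])
    from convergent_prod_LIMSEQ[OF convergent_prod_qpoch[OF this, of "c * z ^ m"]]
    show "(\<lambda>N. \<Prod>j<N. t j z) \<longlonglongrightarrow> qpoch_inf (c * z ^ m) (z ^ m)"
      by (simp add: t_def qpoch_inf_def LIMSEQ_lessThan_iff_atMost)
  qed
  ultimately show "uniform_limit (cball 0 r) (\<lambda>N z. \<Prod>j<N. t j z)
      (\<lambda>z. qpoch_inf (c * z ^ m) (z ^ m)) sequentially"
    by (subst (asm) uniform_limit_cong'[OF refl]) auto
qed

lemma int_taylor_bracelet_gf:
  assumes k: "k \<ge> 1"
  shows "int_taylor (bracelet_gf k)"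
proof -
  have [simp]: "qpoch_inf 0 q = 1" for q
    by (simp add: qpoch_inf_def)
  have nz: "norm (q ^ k) < 1" if "norm q < 1" for q :: complex
    using that k by (auto simp: norm_power intro!: power_less_one_iff[THEN iffD2])
  have "int_taylor (\<lambda>z. qpoch_inf (-1 * z ^ 1) (z ^ 1) *
          inverse (qpoch_inf (1 * z ^ 1) (z ^ 1) ^ (k - 1) * qpoch_inf (-1 * z ^ k) (z ^ k)))"
    using k
    by (intro int_taylor_mult[OF _ int_taylor_inverse] int_taylor_mult int_taylor_power
          int_taylor_qpoch)
       (auto simp: qpoch_inf_nonzero nz power_0_left)
  then show ?thesis
    by (simp add: bracelet_gf_def[abs_def] divide_inverse)
qed

lemma ex1_bracelet_partitions:
  assumes "k \<ge> 1"
  shows "\<exists>!B :: nat \<Rightarrow> int.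
           \<forall>q. norm q < 1 \<longrightarrow> (\<lambda>n. of_int (B n) * q ^ n) sums bracelet_gf k q"
proof (rule ex_ex1I)
  define F where "F = fps_expansion (bracelet_gf k) 0"
  note gf = int_taylor_bracelet_gf[OF assms]
  have "\<exists>b :: int. fps_nth F n = of_int b" for n
    using gf unfolding int_taylor_def F_def by (metis Ints_cases)
  then obtain B :: "nat \<Rightarrow> int" where B: "\<And>n. fps_nth F n = of_int (B n)"
    by metis
  have "(\<lambda>n. fps_nth F n * q ^ n) sums bracelet_gf k q" if "norm q < 1" for q
    unfolding F_def
    by (rule has_fps_expansion_imp_sums_complex[where r = 1, OF int_taylor_expansion[OF gf]])
       (use gf that in \<open>auto simp: int_taylor_def one_ereal_def\<close>)
  then show "\<exists>B :: nat \<Rightarrow> int.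
      \<forall>q. norm q < 1 \<longrightarrow> (\<lambda>n. of_int (B n) * q ^ n) sums bracelet_gf k q"
    unfolding B by blast
next
  fix B C :: "nat \<Rightarrow> int"
  assume B: "\<forall>q. norm q < 1 \<longrightarrow> (\<lambda>n. of_int (B n) * q ^ n) sums bracelet_gf k q"
    and C: "\<forall>q. norm q < 1 \<longrightarrow> (\<lambda>n. of_int (C n) * q ^ n) sums bracelet_gf k q"
  have ev: "\<forall>\<^sub>F q in nhds 0. norm (q :: complex) < 1"
    using eventually_nhds_in_open[of "ball 0 1" "0 :: complex"] by simp
  have "bracelet_gf k has_fps_expansion Abs_fps (\<lambda>n. of_int (B n))"
    by (rule has_fps_expansionI, rule eventually_mono[OF ev]) (use B in auto)
  moreover have "bracelet_gf k has_fps_expansion Abs_fps (\<lambda>n. of_int (C n))"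
    by (rule has_fps_expansionI, rule eventually_mono[OF ev]) (use C in auto)
  ultimately have "Abs_fps (\<lambda>n. of_int (B n) :: complex) = Abs_fps (\<lambda>n. of_int (C n))"
    by (rule fps_expansion_unique_complex)
  then show "B = C"
    by (auto simp: fps_eq_iff)
qed

lemma bracelet_partitions_sums:
  assumes "k \<ge> 1" "norm q < 1"
  shows "(\<lambda>n. of_int (bracelet_partitions k n) * q ^ n) sums bracelet_gf k q"
  using theI'[OF ex1_bracelet_partitions[OF assms(1)]] assms(2)
  unfolding bracelet_partitions_def by blast

end

theory Submission
  imports Defs
begin

text \<open>
  Write $f_m = (q^m; q^m)_\infty$ and $k = p^{2\alpha}$. Since
  $(-q^m; q^m)_\infty = f_{2m} / f_m$, the generating function of the bracelet partitions is
  $f_2 f_k / (f_1^k f_{2k})$. As $k$ is a power of $p$, Frobenius gives $f_1^k \equiv f_k$ modulo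
  $p$, so that $B \cdot f_{2k} \equiv f_2$, where $B$ is the generating series.

  By the pentagonal number theorem, $f_2 = \sum_{m \in \mathbb{Z}} (-1)^m q^{m(3m+1)}$.
  Put $r = p^{2\alpha-1}$ and $c = (k-1)/12$, and keep on both sides of the congruence only the terms
  whose exponent is congruent to $c$ modulo $r$. On the left, $f_{2k}$ is a series in $q^r$, so this
  replaces $B$ by the part of $B$ in that residue class and leaves $f_{2k}$ alone. On the right,
  $12 m(3m+1) + 1 = (6m+1)^2$ and $12 c + 1 = k$, so the surviving $m$ are those for which
  $p^{2\alpha-1}$ divides $(6m+1)^2$, that is, for which $p^\alpha$ divides $6m+1$. Writing
  $6m+1 = \pm p^\alpha (6m'+1)$ one finds $m(3m+1) = k\, m'(3m'+1) + c$: the right-hand side is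
  $\pm q^c f_{2k}$. Cancelling $f_{2k}$, which has constant term 1, shows that the part of $B$ in the
  residue class is $\pm q^c$ modulo $p$. So every coefficient of $B$ with exponent in the class of
  \<open>c\<close>, apart from the one at \<open>c\<close> itself, is divisible by \<open>p\<close>.

  The products are complex functions on the unit disc, whereas reduction modulo $p$ needs integral
  power series. The two meet in \<open>pentagonal_number_theorem\<close>, which expands $f_1$ into the integral
  series \<open>euler_fps\<close>, and in \<open>bracelet_fps_identity\<close>, which moves the product identity from
  functions to series. The arithmetic is in \<open>euler_fps_residue_part\<close>.
\<close>

section \<open>Integral power series modulo a prime\<close>

lemma prime_dvd_power_add_diff:
  fixes a b :: "'a :: comm_ring_1"
  assumes "prime p"
  shows "of_nat p dvd (a + b) ^ p - (a ^ p + b ^ p)"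
proof -
  have p: "p \<ge> 2"
    using assms by (rule prime_ge_2_nat)
  have "(a + b) ^ p = (\<Sum>i\<le>p. of_nat (p choose i) * a ^ i * b ^ (p - i))"
    by (rule binomial_ring)
  also have "{..p} = insert 0 (insert p {0<..<p})"
    using p by auto
  finally have "(a + b) ^ p - (a ^ p + b ^ p)
      = (\<Sum>i\<in>{0<..<p}. of_nat (p choose i) * a ^ i * b ^ (p - i))"
    using p by (simp add: algebra_simps)
  moreover have "of_nat p dvd (of_nat (p choose i) :: 'a)" if "i \<in> {0<..<p}" for i
    
  proof -
    have "p dvd (p choose i)"
      using that assms p by (intro dvd_choose_prime) auto
    then obtain c where "p choose i = p * c" ..
    then show ?thesis
      by simp
  qed
  ultimately show ?thesis
    by (auto intro!: dvd_sum dvd_mult2)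
qed

lemma prime_dvd_power_minus_self:
  fixes a :: int
  assumes "prime p"
  shows "int p dvd a ^ p - a"
proof (induction a rule: int_induct[where k = 0])
  case base
  show ?case
    using prime_gt_0_nat[OF assms] by (simp add: power_0_left)
next
  case (step1 a)
  have "(a + 1) ^ p - (a + 1) = ((a + 1) ^ p - (a ^ p + 1 ^ p)) + (a ^ p - a)"
    by simp
  then show ?case
    using prime_dvd_power_add_diff[OF assms, of a 1] step1 by (metis dvd_add of_nat_eq_id id_apply)
next
  case (step2 a)
  have "(a - 1) ^ p - (a - 1) = (a ^ p - a) - (((a - 1) + 1) ^ p - ((a - 1) ^ p + 1 ^ p))"
    by simp
  then show ?case
    using prime_dvd_power_add_diff[OF assms, of "a - 1" 1] step2
    by (metis dvd_diff of_nat_eq_id id_apply)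
qed

lemma fps_compose_X_power_nth:
  fixes F :: "'a :: comm_ring_1 fps"
  assumes "m \<ge> 1"
  shows "fps_nth (F oo fps_X ^ m) n = (if m dvd n then fps_nth F (n div m) else 0)"
proof -
  have "fps_nth (F oo fps_X ^ m) n = (\<Sum>i=0..n. if n = m * i then fps_nth F i else 0)"
    by (auto simp: fps_compose_nth power_mult[symmetric] intro!: sum.cong)
  also have "\<dots> = (if m dvd n then fps_nth F (n div m) else 0)"
  proof (cases "m dvd n")
    case True
    then obtain j where j: "n = m * j" ..
    have "(n = m * i) = (j = i)" for i
      using j assms by auto
    then show ?thesis
      using j assms True by simp
  qed (auto intro!: sum.neutral)
  finally show ?thesis .
qed

lemma of_nat_dvd_fps_iff:
  fixes F :: "int fps"
  shows "of_nat p dvd F \<longleftrightarrow> (\<forall>n. int p dvd fps_nth F n)"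
proof
  assume "of_nat p dvd F"
  then obtain K where "F = of_nat p * K" ..
  then show "\<forall>n. int p dvd fps_nth F n"
    by (simp flip: fps_of_nat)
next
  assume "\<forall>n. int p dvd fps_nth F n"
  then have "F = of_nat p * Abs_fps (\<lambda>n. fps_nth F n div int p)"
    by (simp add: fps_eq_iff flip: fps_of_nat)
  then show "of_nat p dvd F" ..
qed

text \<open>
  By strong induction on the coefficient index: split $F = a + XG$. Modulo \<open>p\<close> the power of the sum
  is $a^p + X^p G^p$, where $a^p \equiv a$ by Fermat's little theorem, and the claim for \<open>G\<close> is only
  needed at an index smaller by \<open>p\<close>.
\<close>
lemma fps_power_prime_cong:
  fixes F :: "int fps"
  assumes "prime p"
  shows "of_nat p dvd F ^ p - (F oo fps_X ^ p)"
proof -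
  have p: "p \<ge> 1"
    using prime_ge_1_nat[OF assms] .
  have "int p dvd fps_nth (F ^ p - (F oo fps_X ^ p)) n" for n
  proof (induction n arbitrary: F rule: less_induct)
    case (less n)
    define a G where "a = fps_nth F 0" and "G = fps_shift 1 F"
    have F: "F = fps_const a + fps_X * G"
      by (auto simp: a_def G_def fps_eq_iff fps_X_mult_nth)
    have comp: "F oo fps_X ^ p = fps_const a + fps_X ^ p * (G oo fps_X ^ p)"
      by (subst F) (use p in \<open>simp add: fps_compose_add_distrib fps_compose_mult_distrib\<close>)
    have eq: "F ^ p - (F oo fps_X ^ p) = (F ^ p - (fps_const a ^ p + (fps_X * G) ^ p))
        + fps_const (a ^ p - a) + fps_X ^ p * (G ^ p - (G oo fps_X ^ p))"
      by (subst comp) (simp add: algebra_simps fps_const_power flip: fps_const_sub)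
    have "int p dvd fps_nth (F ^ p - (fps_const a ^ p + (fps_X * G) ^ p)) n"
      using prime_dvd_power_add_diff[OF assms, of "fps_const a" "fps_X * G"]
      by (simp only: of_nat_dvd_fps_iff flip: F)
    moreover have "int p dvd fps_nth (fps_const (a ^ p - a)) n"
      using prime_dvd_power_minus_self[OF assms, of a] by simp
    moreover have "int p dvd fps_nth (fps_X ^ p * (G ^ p - (G oo fps_X ^ p))) n"
      using less[of "n - p" G] p by (auto simp: fps_X_power_mult_nth simp del: fps_sub_nth)
    ultimately show ?case
      unfolding eq fps_add_nth by (intro dvd_add)
  qed
  then show ?thesis
    by (simp add: of_nat_dvd_fps_iff)
qed

lemma fps_power_prime_power_cong:
  fixes F :: "int fps"
  assumes "prime p"
  shows "of_nat p dvd F ^ (p ^ a) - (F oo fps_X ^ (p ^ a))"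
proof (induction a)
  case (Suc a)
  let ?G = "F oo fps_X ^ (p ^ a)"
  have p: "p \<ge> 1"
    using prime_ge_1_nat[OF assms] .
  have "F ^ (p ^ a) - ?G dvd (F ^ (p ^ a)) ^ p - ?G ^ p"
    by (simp add: power_diff_sumr2)
  with Suc have "of_nat p dvd (F ^ (p ^ a)) ^ p - ?G ^ p"
    by (rule dvd_trans)
  moreover have "of_nat p dvd ?G ^ p - (?G oo fps_X ^ p)"
    by (rule fps_power_prime_cong[OF assms])
  ultimately have "of_nat p dvd ((F ^ (p ^ a)) ^ p - ?G ^ p) + (?G ^ p - (?G oo fps_X ^ p))"
    by (rule dvd_add)
  moreover have "?G oo fps_X ^ p = F oo fps_X ^ (p ^ Suc a)"
    using p by (auto simp: fps_eq_iff fps_compose_X_power_nth div_mult2_eq dvd_div_iff_mult mult.commute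
        dest: dvd_mult_left)
  ultimately show ?case
    by (simp add: power_mult[symmetric] mult.commute)
qed simp

lemma fps_dvd_cancel_unit:
  fixes F U :: "'a :: comm_ring_1 fps"
  assumes "d dvd F * U" and "fps_nth U 0 = 1"
  shows "d dvd F"
proof -
  have "U * fps_right_inverse U 1 = 1"
    by (rule fps_right_inverse) (simp add: assms)
  then have "F * U * fps_right_inverse U 1 = F"
    by (simp add: mult.assoc)
  then show ?thesis
    using assms(1) by (metis dvd_mult2)
qed

section \<open>Residue classes of exponents\<close>

definition fps_residue_part :: "nat \<Rightarrow> nat \<Rightarrow> 'a :: zero fps \<Rightarrow> 'a fps" where
  "fps_residue_part r c F = Abs_fps (\<lambda>n. if [n = c] (mod r) then fps_nth F n else 0)"

text \<open>
  Multiplication by a series in $X^r$ shifts exponents by multiples of \<open>r\<close> and so respects the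
  residue classes.
\<close>
lemma fps_residue_part_mult:
  fixes F U :: "'a :: comm_ring_1 fps"
  assumes "\<And>n. fps_nth U n \<noteq> 0 \<Longrightarrow> r dvd n"
  shows "fps_residue_part r c (F * U) = fps_residue_part r c F * U"
proof -
  have iff: "[n = c] (mod r) \<longleftrightarrow> [i = c] (mod r)" if "i \<le> n" "fps_nth U (n - i) \<noteq> 0" for n i
  proof -
    have "[n = i] (mod r)"
      using assms[OF that(2)] that(1) by (simp add: cong_altdef_nat)
    then show ?thesis
      by (meson cong_sym cong_trans)
  qed
  show ?thesis
  proof (rule fps_ext)
    fix n
    have "fps_nth (fps_residue_part r c (F * U)) n
        = (\<Sum>i=0..n. if [n = c] (mod r) then fps_nth F i * fps_nth U (n - i) else 0)"
      by (simp add: fps_residue_part_def fps_mult_nth)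
    also have "\<dots> = fps_nth (fps_residue_part r c F * U) n"
      unfolding fps_mult_nth fps_residue_part_def
    proof (intro sum.cong refl)
      fix i assume "i \<in> {0..n}"
      then show "(if [n = c] (mod r) then fps_nth F i * fps_nth U (n - i) else 0)
          = fps_nth (Abs_fps (\<lambda>n. if [n = c] (mod r) then fps_nth F n else 0)) i
            * fps_nth U (n - i)"
        using iff[of i n] by (cases "fps_nth U (n - i) = 0") auto
    qed
    finally show "fps_nth (fps_residue_part r c (F * U)) n
        = fps_nth (fps_residue_part r c F * U) n" .
  qed
qed

lemma dvd_fps_residue_part:
  fixes F G :: "int fps"
  assumes "of_nat p dvd F - G"
  shows "of_nat p dvd fps_residue_part r c F - fps_residue_part r c G"
  using assms by (auto simp: of_nat_dvd_fps_iff fps_residue_part_def)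

section \<open>The pentagonal number theorem\<close>

text \<open>
  The sign $(-1)^m$ for integers \<open>m\<close> of either sign, without division.
\<close>
definition parity_sign :: "int \<Rightarrow> int" where
  "parity_sign m = (if even m then 1 else - 1)"

definition pentagonal :: "int \<Rightarrow> nat" where
  "pentagonal m = nat (m * (3 * m + 1) div 2)"

text \<open>
  The sum has at most one term (\<open>pentagonal_inj\<close>). Writing the coefficient as a sum over all solutions
  rather than selecting one allows substitutions in \<open>m\<close> to act as reindexing of sums.
\<close>
definition euler_fps :: "int fps" where
  "euler_fps = Abs_fps (\<lambda>n. \<Sum>m | m * (3 * m + 1) = 2 * int n. parity_sign m)"

lemma twice_pentagonal: "2 * int (pentagonal m) = m * (3 * m + 1)"
proof -
  have "m * (3 * m + 1) \<ge> 0"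
    by (cases "m \<ge> 0") (auto intro: mult_nonpos_nonpos)
  moreover have "even (m * (3 * m + 1))"
    by auto
  ultimately show ?thesis
    by (simp add: pentagonal_def)
qed

lemma pentagonal_eq_iff: "m * (3 * m + 1) = 2 * int n \<longleftrightarrow> pentagonal m = n"
  using twice_pentagonal[of m] by auto

lemma pentagonal_inj: "inj pentagonal"
proof (rule injI)
  fix m n assume "pentagonal m = pentagonal n"
  then have "m * (3 * m + 1) = n * (3 * n + 1)"
    using twice_pentagonal by metis
  then have "(m - n) * (3 * (m + n) + 1) = 0"
    by (simp add: algebra_simps)
  moreover have "3 * (m + n) + 1 \<noteq> 0"
    by presburger
  ultimately show "m = n"
    by simp
qed

text \<open>
  The generalized pentagonal numbers increase along the order $0, -1, 1, -2, 2, \ldots$ of their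
  indices, so a symmetric range of indices is an initial segment of values.
\<close>
lemma pentagonal_less_iff: "pentagonal m < pentagonal (- int (Suc N)) \<longleftrightarrow> m \<in> {- int N..int N}"
proof -
  have mono: "a * (3 * a + b) \<le> c * (3 * c + b)" if "0 \<le> a" "a \<le> c" "- 1 \<le> b" "a > 0 \<or> b \<ge> 0"
    for a b c :: int
    using that by (intro mult_mono) auto
  have "2 * int (pentagonal m) < 2 * int (pentagonal (- int (Suc N))) \<longleftrightarrow> m \<in> {- int N..int N}"
  proof (cases "m \<ge> 0")
    case True
    then show ?thesis
      unfolding twice_pentagonal using mono[of m "int N" 1] mono[of "int N + 1" m 1]
      by (cases "m \<le> int N") (auto simp: algebra_simps)
  next
    case False
    then show ?thesis
      unfolding twice_pentagonal using mono[of "- m" "int N" "-1"] mono[of "int N + 1" "- m" "-1"]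
      by (cases "- m \<le> int N") (auto simp: algebra_simps)
  qed
  then show ?thesis
    by simp
qed

text \<open>
  Shanks' identity produces symmetric partial sums over the index \<open>m\<close>; convergence is a matter of the
  partial sums of a power series.
\<close>
lemma pentagonal_sum_eq:
  fixes x :: "'a :: comm_ring_1"
  shows "(\<Sum>m=-int N..int N. of_int (parity_sign m) * x ^ pentagonal m)
       = (\<Sum>n<pentagonal (- int (Suc N)). of_int (fps_nth euler_fps n) * x ^ n)"
proof -
  let ?K = "pentagonal (- int (Suc N))"
  have "(\<Sum>n<?K. of_int (fps_nth euler_fps n) * x ^ n)
      = (\<Sum>n<?K. \<Sum>m | m \<in> {-int N..int N} \<and> pentagonal m = n.
            of_int (parity_sign m) * x ^ pentagonal m)"
  proof (rule sum.cong[OF refl])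
    fix n assume "n \<in> {..<?K}"
    then have "m \<in> {-int N..int N}" if "pentagonal m = n" for m
      using that by (simp only: lessThan_iff flip: pentagonal_less_iff)
    then have "{m. m * (3 * m + 1) = 2 * int n} = {m. m \<in> {-int N..int N} \<and> pentagonal m = n}"
      unfolding pentagonal_eq_iff by blast
    then show "of_int (fps_nth euler_fps n) * x ^ n
        = (\<Sum>m | m \<in> {-int N..int N} \<and> pentagonal m = n.
            of_int (parity_sign m) * x ^ pentagonal m)"
      by (simp add: euler_fps_def sum_distrib_right)
  qed
  also have "\<dots> = (\<Sum>m=-int N..int N. of_int (parity_sign m) * x ^ pentagonal m)"
  proof (rule sum.group)
    show "pentagonal ` {-int N..int N} \<subseteq> {..<?K}"
      by (auto simp only: lessThan_iff pentagonal_less_iff)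
  qed auto
  finally show ?thesis ..
qed

definition triangular :: "nat \<Rightarrow> nat" where
  "triangular s = s * (s + 1) div 2"

lemma triangular_0: "triangular 0 = 0"
  and triangular_Suc: "triangular (Suc s) = triangular s + Suc s"
  by (simp_all add: triangular_def)

lemma pentagonal_conv_triangular:
  "pentagonal (int n) = n * n + triangular n"
  "pentagonal (- int (Suc n)) = Suc n * Suc n + triangular n"
proof -
  have tri: "2 * int (triangular n) = int n * (int n + 1)" for n
    by (induction n) (auto simp: triangular_0 triangular_Suc algebra_simps)
  have "2 * int (pentagonal (int n)) = 2 * int (n * n + triangular n)"
    unfolding twice_pentagonal using tri[of n] by (simp add: algebra_simps)
  then show "pentagonal (int n) = n * n + triangular n"
    by (simp del: of_nat_add of_nat_mult of_nat_Suc)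
  have "2 * int (pentagonal (- int (Suc n))) = 2 * int (Suc n * Suc n + triangular n)"
    unfolding twice_pentagonal using tri[of n] by (simp add: algebra_simps)
  then show "pentagonal (- int (Suc n)) = Suc n * Suc n + triangular n"
    by (simp del: of_nat_add of_nat_mult of_nat_Suc)
qed

lemma parity_sign_of_nat: "of_int (parity_sign (int n)) = ((- 1) ^ n :: 'a :: ring_1)"
  by (simp add: parity_sign_def)

lemma parity_sign_minus: "parity_sign (- m) = parity_sign m"
  by (simp add: parity_sign_def)

text \<open>
  Shanks' finite form of the pentagonal number theorem. The terms $s \geq 1$ on the left are divisible
  by $x^N$, so in the limit only the product for $s = 0$ remains. In the
  induction the summand $s = N + 1$ is the new term with $m = N + 1$, and the difference of the other
  summands telescopes to the new term with $m = -(N+1)$.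
\<close>
lemma shanks_identity:
  fixes x :: "'a :: comm_ring_1"
  shows "(\<Sum>s\<le>N. (- 1) ^ s * (\<Prod>j\<in>{s<..N}. 1 - x ^ j) * x ^ (s * N + triangular s))
       = (\<Sum>m=-int N..int N. of_int (parity_sign m) * x ^ pentagonal m)"
proof (induction N)
  case 0
  then show ?case
    by (simp add: parity_sign_def pentagonal_def triangular_0)
next
  case (Suc N)
  define t where "t = (\<lambda>N s. (- 1) ^ s * (\<Prod>j\<in>{s<..N}. 1 - x ^ j) * x ^ (s * N + triangular s))"
  \<comment> \<open>At $s = 0$ the product contains the factor $1 - x^0$, so \<open>T 0\<close> vanishes.\<close>
  define T where "T = (\<lambda>s. (- 1) ^ s * (\<Prod>j\<in>{s..N}. 1 - x ^ j) * x ^ (s * Suc N + triangular (s - 1)))"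
  have tele: "t (Suc N) s - t N s = T (Suc s) - T s" if "s \<le> N" for s
  proof -
    define Q y where "Q = (\<Prod>j\<in>{s<..N}. 1 - x ^ j)" and "y = x ^ (s * N + triangular s)"
    have "{s<..Suc N} = insert (Suc N) {s<..N}"
      using that by auto
    then have t1: "t (Suc N) s = (- 1) ^ s * ((1 - x ^ Suc N) * Q) * (x ^ s * y)"
      by (simp add: t_def Q_def y_def power_add algebra_simps)
    have t0: "t N s = (- 1) ^ s * Q * y"
      by (simp add: t_def Q_def y_def)
    have "{Suc s..N} = {s<..N}"
      by auto
    then have T1: "T (Suc s) = - ((- 1) ^ s * Q * (x ^ Suc N * x ^ s * y))"
      by (simp add: T_def Q_def y_def power_add algebra_simps)
    have "{s..N} = insert s {s<..N}"
      using that by auto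
    moreover have "x ^ (s * Suc N + triangular (s - 1)) = y" if "s > 0"
      using that by (cases s) (auto simp: y_def triangular_Suc algebra_simps)
    ultimately have T0: "T s = (- 1) ^ s * ((1 - x ^ s) * Q) * y"
      unfolding T_def Q_def by (cases "s = 0") auto
    show ?thesis
      unfolding t1 t0 T1 T0 by (simp add: algebra_simps)
  qed
  have "(\<Sum>s\<le>N. t (Suc N) s) - (\<Sum>s\<le>N. t N s) = (\<Sum>s\<le>N. T (Suc s) - T s)"
    unfolding sum_subtractf[symmetric] using tele by (intro sum.cong) auto
  also have "\<dots> = T (Suc N) - T 0"
    by (induction N) auto
  also have "T 0 = 0"
  proof -
    have "(\<Prod>j\<in>{0..N}. 1 - x ^ j) = 0"
      by (rule prod_zero) (auto intro: bexI[of _ 0])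
    then show ?thesis
      by (simp add: T_def)
  qed
  also have "T (Suc N) = of_int (parity_sign (- int (Suc N))) * x ^ pentagonal (- int (Suc N))"
    unfolding parity_sign_minus parity_sign_of_nat pentagonal_conv_triangular by (simp add: T_def)
  finally have diff: "(\<Sum>s\<le>N. t (Suc N) s) = (\<Sum>s\<le>N. t N s)
      + of_int (parity_sign (- int (Suc N))) * x ^ pentagonal (- int (Suc N))"
    by (simp add: algebra_simps)
  have top: "t (Suc N) (Suc N) = of_int (parity_sign (int (Suc N))) * x ^ pentagonal (int (Suc N))"
    unfolding parity_sign_of_nat pentagonal_conv_triangular by (simp add: t_def)
  have set: "{- int (Suc N)..int (Suc N)}
      = insert (int (Suc N)) (insert (- int (Suc N)) {- int N..int N})"
    by auto
  have "(\<Sum>s\<le>Suc N. t (Suc N) s) = (\<Sum>s\<le>N. t N s)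
      + of_int (parity_sign (- int (Suc N))) * x ^ pentagonal (- int (Suc N))
      + of_int (parity_sign (int (Suc N))) * x ^ pentagonal (int (Suc N))"
    by (simp only: sum.atMost_Suc diff top)
  also have "(\<Sum>s\<le>N. t N s) = (\<Sum>m=-int N..int N. of_int (parity_sign m) * x ^ pentagonal m)"
    using Suc by (simp add: t_def)
  finally show ?case
    unfolding set t_def by (simp add: add_ac)
qed

lemma euler_fps_nth_bounded: "\<bar>fps_nth euler_fps n\<bar> \<le> 1"
proof -
  have "{m. m * (3 * m + 1) = 2 * int n} = pentagonal -` {n}"
    by (auto simp: pentagonal_eq_iff)
  then have card: "card {m. m * (3 * m + 1) = 2 * int n} \<le> 1"
    using card_vimage_inj_on_le[OF pentagonal_inj, of "{n}"] by simp
  have "\<bar>fps_nth euler_fps n\<bar> \<le> (\<Sum>m | m * (3 * m + 1) = 2 * int n. \<bar>parity_sign m\<bar>)"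
    unfolding euler_fps_def fps_nth_Abs_fps by (rule sum_abs)
  also have "\<dots> = int (card {m. m * (3 * m + 1) = 2 * int n})"
    by (simp add: parity_sign_def if_distrib cong: if_cong)
  finally show ?thesis
    using card by linarith
qed

text \<open>
  A bound that is uniform in the set of factors, used for the terms with $s \geq 1$ in Shanks'
  identity.
\<close>
lemma norm_prod_one_minus_power_le:
  fixes z :: complex
  assumes "norm z < 1" and "finite A"
  shows "norm (\<Prod>j\<in>A. 1 - z ^ j) \<le> exp (1 / (1 - norm z))"
proof -
  have "norm (\<Prod>j\<in>A. 1 - z ^ j) = (\<Prod>j\<in>A. norm (1 - z ^ j))"
    by (simp add: prod_norm)
  also have "\<dots> \<le> (\<Prod>j\<in>A. exp (norm z ^ j))"
  proof (intro prod_mono conjI)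
    fix j
    have "norm (1 - z ^ j) \<le> 1 + norm z ^ j"
      using norm_triangle_ineq4[of 1 "z ^ j"] by (simp add: norm_power)
    also have "\<dots> \<le> exp (norm z ^ j)"
      by (rule exp_ge_add_one_self)
    finally show "norm (1 - z ^ j) \<le> exp (norm z ^ j)" .
  qed auto
  also have "\<dots> = exp (\<Sum>j\<in>A. norm z ^ j)"
    using assms by (simp add: exp_sum)
  also have "(\<Sum>j\<in>A. norm z ^ j) \<le> (\<Sum>j. norm z ^ j)"
    using assms by (intro sum_le_suminf) (auto intro: summable_geometric)
  also have "\<dots> = 1 / (1 - norm z)"
    using assms by (intro suminf_geometric) auto
  finally show ?thesis
    by simp
qed

text \<open>
  Both sides are limits of the two sides of Shanks' identity. On the left the term $s = 0$ tends to the
  infinite product, and the other \<open>N\<close> terms are each bounded by a constant times $|z|^N$.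
\<close>
lemma pentagonal_number_theorem:
  fixes z :: complex
  assumes z: "norm z < 1"
  shows "(\<lambda>n. of_int (fps_nth euler_fps n) * z ^ n) sums qpoch_inf z z"
proof -
  \<comment> \<open>\<open>K N\<close> is the first exponent missed by the indices from $-N$ to $N$.\<close>
  define K where "K = (\<lambda>N. pentagonal (- int (Suc N)))"
  define f where "f = (\<lambda>n. of_int (fps_nth euler_fps n) * z ^ n)"
  define t where "t = (\<lambda>N s. (- 1) ^ s * (\<Prod>j\<in>{s<..N}. 1 - z ^ j) * z ^ (s * N + triangular s))"
  have "summable f"
  proof (rule summable_comparison_test')
    show "summable (\<lambda>n. norm z ^ n)"
      using z by (simp add: summable_geometric)
    show "norm (f n) \<le> norm z ^ n" for n
    proof -
      have "norm (of_int (fps_nth euler_fps n) :: complex) \<le> 1"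
        using euler_fps_nth_bounded[of n] by simp
      then show ?thesis
        unfolding f_def norm_mult norm_power by (intro mult_left_le_one_le) auto
    qed
  qed
  then have "f sums suminf f"
    by (rule summable_sums)
  moreover have "filterlim K at_top sequentially"
  proof (rule filterlim_at_top_mono[OF filterlim_ident])
    show "\<forall>\<^sub>F N in sequentially. N \<le> K N"
      unfolding K_def pentagonal_conv_triangular by simp
  qed
  ultimately have "(\<lambda>N. \<Sum>n<K N. f n) \<longlonglongrightarrow> suminf f"
    unfolding sums_def by (rule filterlim_compose)
  also have "(\<lambda>N. \<Sum>n<K N. f n) = (\<lambda>N. \<Sum>s\<le>N. t N s)"
    unfolding K_def f_def t_def shanks_identity pentagonal_sum_eq ..
  finally have lim1: "(\<lambda>N. \<Sum>s\<le>N. t N s) \<longlonglongrightarrow> suminf f" .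

  have "(\<lambda>N. \<Prod>j\<le>N. 1 - z * z ^ j) \<longlonglongrightarrow> qpoch_inf z z"
    unfolding qpoch_inf_def by (intro convergent_prod_LIMSEQ convergent_prod_qpoch z)
  then have "(\<lambda>N. \<Prod>j<N. 1 - z ^ Suc j) \<longlonglongrightarrow> qpoch_inf z z"
    by (simp add: LIMSEQ_lessThan_iff_atMost)
  also have "(\<lambda>N. \<Prod>j<N. 1 - z ^ Suc j) = (\<lambda>N. t N 0)"
    by (simp add: t_def triangular_0 prod.atLeast1_atMost_eq flip: atLeastSucAtMost_greaterThanAtMost)
  finally have lim2: "(\<lambda>N. t N 0) \<longlonglongrightarrow> qpoch_inf z z" .

  have lim3: "(\<lambda>N. \<Sum>s=1..N. t N s) \<longlonglongrightarrow> 0"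
  proof (rule Lim_null_comparison)
    define C where "C = exp (1 / (1 - norm z))"
    show "\<forall>\<^sub>F N in sequentially. norm (\<Sum>s=1..N. t N s) \<le> C * (real N * norm z ^ N)"
    proof (intro always_eventually allI)
      fix N
      have "norm (t N s) \<le> C * norm z ^ N" if "s \<in> {1..N}" for s
      proof -
        have "norm (t N s) = norm (\<Prod>j\<in>{s<..N}. 1 - z ^ j) * norm z ^ (s * N + triangular s)"
          by (simp add: t_def norm_mult norm_power)
        also have "\<dots> \<le> C * norm z ^ N"
        proof (rule mult_mono)
          show "norm (\<Prod>j\<in>{s<..N}. 1 - z ^ j) \<le> C"
            unfolding C_def by (rule norm_prod_one_minus_power_le) (use z in auto)
          show "norm z ^ (s * N + triangular s) \<le> norm z ^ N"
            using z that by (intro power_decreasing) (auto simp: trans_le_add1)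
        qed (auto simp: C_def)
        finally show ?thesis .
      qed
      then have "norm (\<Sum>s=1..N. t N s) \<le> (\<Sum>s=1..N. C * norm z ^ N)"
        by (rule sum_norm_le)
      then show "norm (\<Sum>s=1..N. t N s) \<le> C * (real N * norm z ^ N)"
        by (simp add: mult_ac)
    qed
    show "(\<lambda>N. C * (real N * norm z ^ N)) \<longlonglongrightarrow> 0"
      using tendsto_mult_right_zero[OF powser_times_n_limit_0[of "norm z"], of C] z by simp
  qed
  have "(\<Sum>s\<le>N. t N s) = t N 0 + (\<Sum>s=1..N. t N s)" for N
    by (simp add: sum.atLeast_Suc_atMost flip: atLeast0AtMost)
  then have "(\<lambda>N. \<Sum>s\<le>N. t N s) \<longlonglongrightarrow> qpoch_inf z z"
    using tendsto_add[OF lim2 lim3] by simp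
  with lim1 have "suminf f = qpoch_inf z z"
    by (rule LIMSEQ_unique)
  with \<open>f sums suminf f\<close> show ?thesis
    by (simp add: f_def)
qed

lemma euler_fps_compose_sums:
  fixes z :: complex
  assumes "norm z < 1" "m \<ge> 1"
  shows "(\<lambda>n. of_int (fps_nth (euler_fps oo fps_X ^ m) n) * z ^ n) sums qpoch_inf (z ^ m) (z ^ m)"
proof -
  let ?f = "\<lambda>n. of_int (fps_nth (euler_fps oo fps_X ^ m) n) * z ^ n"
  have "norm (z ^ m) < 1"
    using assms by (auto simp: norm_power intro!: power_less_one_iff[THEN iffD2])
  from pentagonal_number_theorem[OF this]
  have "(\<lambda>n. ?f (m * n)) sums qpoch_inf (z ^ m) (z ^ m)"
    using assms by (simp add: fps_compose_X_power_nth power_mult)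
  moreover have "strict_mono (\<lambda>n. m * n)"
    using assms by (auto simp: strict_mono_def)
  moreover have "?f n = 0" if "n \<notin> range (\<lambda>n. m * n)" for n
    using that assms by (auto simp: fps_compose_X_power_nth elim!: dvdE)
  ultimately show ?thesis
    using sums_mono_reindex[of "\<lambda>n. m * n" ?f] by blast
qed

section \<open>The generating function of bracelet partitions\<close>

lemma qpoch_inf_minus_mult_qpoch_inf:
  assumes "norm q < 1"
  shows "qpoch_inf (- q) q * qpoch_inf q q = qpoch_inf (q ^ 2) (q ^ 2)"
proof (rule LIMSEQ_unique)
  have q2: "norm (q ^ 2) < 1"
    using assms by (simp add: norm_power power_less_one_iff)
  show "(\<lambda>N. \<Prod>j\<le>N. 1 - q ^ 2 * (q ^ 2) ^ j) \<longlonglongrightarrow> qpoch_inf (q ^ 2) (q ^ 2)"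
    unfolding qpoch_inf_def by (intro convergent_prod_LIMSEQ convergent_prod_qpoch q2)
  have "(\<lambda>N. (\<Prod>j\<le>N. 1 - (- q) * q ^ j) * (\<Prod>j\<le>N. 1 - q * q ^ j))
      \<longlonglongrightarrow> qpoch_inf (- q) q * qpoch_inf q q"
    unfolding qpoch_inf_def
    by (intro tendsto_mult convergent_prod_LIMSEQ convergent_prod_qpoch assms)
  moreover have "(1 - (- q) * q ^ j) * (1 - q * q ^ j) = 1 - q ^ 2 * (q ^ 2) ^ j" for j
    by (simp add: algebra_simps power2_eq_square power_mult_distrib)
  ultimately show "(\<lambda>N. \<Prod>j\<le>N. 1 - q ^ 2 * (q ^ 2) ^ j)
      \<longlonglongrightarrow> qpoch_inf (- q) q * qpoch_inf q q"
    by (simp only: prod.distrib[symmetric])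
qed

text \<open>
  All denominators are cleared, so that the identity transfers to integral power series.
\<close>
lemma bracelet_gf_product_identity:
  assumes q: "norm q < 1" and k: "k \<ge> 1"
  shows "bracelet_gf k q * qpoch_inf q q ^ k * qpoch_inf (q ^ (2 * k)) (q ^ (2 * k))
       = qpoch_inf (q ^ 2) (q ^ 2) * qpoch_inf (q ^ k) (q ^ k)"
proof -
  have qk: "norm (q ^ k) < 1"
    using assms by (auto simp: norm_power intro!: power_less_one_iff[THEN iffD2])
  define f g h where "f = qpoch_inf q q" and "g = qpoch_inf (- (q ^ k)) (q ^ k)"
    and "h = qpoch_inf (q ^ k) (q ^ k)"
  have nz: "f \<noteq> 0" "g \<noteq> 0"
    using q qk by (simp_all add: f_def g_def qpoch_inf_nonzero)
  have "qpoch_inf (q ^ (2 * k)) (q ^ (2 * k)) = g * h"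
    using qpoch_inf_minus_mult_qpoch_inf[OF qk] by (simp add: g_def h_def mult.commute flip: power_mult)
  moreover have "f ^ k = f * f ^ (k - 1)"
    using k by (simp add: power_eq_if)
  ultimately show ?thesis
    using nz qpoch_inf_minus_mult_qpoch_inf[OF q]
    by (simp add: bracelet_gf_def field_simps flip: f_def g_def h_def)
qed

definition complex_fps :: "int fps \<Rightarrow> complex fps" where
  "complex_fps F = Abs_fps (\<lambda>n. of_int (fps_nth F n))"

lemma complex_fps_mult: "complex_fps (F * G) = complex_fps F * complex_fps G"
  by (simp add: complex_fps_def fps_eq_iff fps_mult_nth)

lemma complex_fps_power: "complex_fps (F ^ n) = complex_fps F ^ n"
  by (induction n) (simp_all add: complex_fps_mult, simp add: complex_fps_def fps_eq_iff)

lemma complex_fps_eq_iff: "complex_fps F = complex_fps G \<longleftrightarrow> F = G"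
  by (simp add: complex_fps_def fps_eq_iff)

lemma has_fps_expansion_complex_fps:
  assumes "\<And>z. norm z < 1 \<Longrightarrow> (\<lambda>n. of_int (fps_nth F n) * z ^ n) sums f z"
  shows "f has_fps_expansion complex_fps F"
proof (rule has_fps_expansionI)
  have "\<forall>\<^sub>F z in nhds 0. norm (z :: complex) < 1"
    using eventually_nhds_in_open[of "ball 0 1" "0 :: complex"] by simp
  then show "\<forall>\<^sub>F z in nhds 0. (\<lambda>n. fps_nth (complex_fps F) n * z ^ n) sums f z"
    by (rule eventually_mono) (simp add: complex_fps_def assms)
qed

lemma bracelet_fps_identity:
  assumes k: "k \<ge> 1"
  shows "Abs_fps (bracelet_partitions k) * euler_fps ^ k * (euler_fps oo fps_X ^ (2 * k))
       = (euler_fps oo fps_X ^ 2) * (euler_fps oo fps_X ^ k)"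
    (is "?B * _ * _ = _")
proof -
  have euler: "(\<lambda>z. qpoch_inf (z ^ m) (z ^ m)) has_fps_expansion complex_fps (euler_fps oo fps_X ^ m)"
    if "m \<ge> 1" for m
    by (rule has_fps_expansion_complex_fps) (rule euler_fps_compose_sums[OF _ that])
  have "(\<lambda>z. qpoch_inf z z) has_fps_expansion complex_fps euler_fps"
    using euler[of 1] by simp
  moreover have "bracelet_gf k has_fps_expansion complex_fps ?B"
    by (rule has_fps_expansion_complex_fps) (simp add: bracelet_partitions_sums[OF k])
  ultimately have lhs: "(\<lambda>z. bracelet_gf k z * qpoch_inf z z ^ k * qpoch_inf (z ^ (2 * k)) (z ^ (2 * k)))
      has_fps_expansion complex_fps (?B * euler_fps ^ k * (euler_fps oo fps_X ^ (2 * k)))"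
    unfolding complex_fps_mult complex_fps_power using k
    by (intro has_fps_expansion_mult has_fps_expansion_power euler) auto
  have rhs: "(\<lambda>z. qpoch_inf (z ^ 2) (z ^ 2) * qpoch_inf (z ^ k) (z ^ k))
      has_fps_expansion complex_fps ((euler_fps oo fps_X ^ 2) * (euler_fps oo fps_X ^ k))"
    unfolding complex_fps_mult using k by (intro has_fps_expansion_mult euler) auto
  have "\<forall>\<^sub>F z in nhds 0. bracelet_gf k z * qpoch_inf z z ^ k * qpoch_inf (z ^ (2 * k)) (z ^ (2 * k))
      = qpoch_inf (z ^ 2) (z ^ 2) * qpoch_inf (z ^ k) (z ^ k)"
  proof -
    have "\<forall>\<^sub>F z in nhds 0. norm (z :: complex) < 1"
      using eventually_nhds_in_open[of "ball 0 1" "0 :: complex"] by simp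
    then show ?thesis
      by (rule eventually_mono) (rule bracelet_gf_product_identity[OF _ k])
  qed
  from iffD1[OF has_fps_expansion_cong[OF this refl] lhs] rhs
  have "complex_fps (?B * euler_fps ^ k * (euler_fps oo fps_X ^ (2 * k)))
      = complex_fps ((euler_fps oo fps_X ^ 2) * (euler_fps oo fps_X ^ k))"
    by (rule fps_expansion_unique_complex)
  then show ?thesis
    by (simp only: complex_fps_eq_iff)
qed

lemma euler_fps_nth_0: "fps_nth euler_fps 0 = 1"
proof -
  have "{m. m * (3 * m + 1) = 2 * int 0} = {0}"
    using inj_eq[OF pentagonal_inj, of _ 0] unfolding pentagonal_eq_iff
    by (auto simp: pentagonal_def)
  then show ?thesis
    by (simp add: euler_fps_def parity_sign_def)
qed

text \<open>
  In the identity for the generating series, $f_1^k$ may be replaced by $f_k$ because \<open>k\<close> is a power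
  of \<open>p\<close>; then $f_k$ cancels.
\<close>
lemma bracelet_fps_cong:
  assumes "prime p" and k: "k = p ^ a"
  shows "of_nat p dvd
    Abs_fps (bracelet_partitions k) * (euler_fps oo fps_X ^ (2 * k)) - (euler_fps oo fps_X ^ 2)"
    (is "_ dvd ?B * ?E2k - ?E2")
proof (rule fps_dvd_cancel_unit)
  let ?Ek = "euler_fps oo fps_X ^ k"
  have k1: "k \<ge> 1"
    using prime_gt_0_nat[OF assms(1)] k by simp
  have "(?B * ?E2k - ?E2) * ?Ek = ?B * ?E2k * ?Ek - ?B * euler_fps ^ k * ?E2k"
    using bracelet_fps_identity[OF k1] by (simp add: algebra_simps)
  also have "\<dots> = - (?B * ?E2k) * (euler_fps ^ k - ?Ek)"
    by (simp add: algebra_simps)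
  finally show "of_nat p dvd (?B * ?E2k - ?E2) * ?Ek"
    using fps_power_prime_power_cong[OF assms(1), of euler_fps a] k by simp
  show "fps_nth ?Ek 0 = 1"
    by (simp add: euler_fps_nth_0)
qed

section \<open>Pentagonal exponents in a residue class\<close>

lemma euler_fps_compose_even_nth:
  assumes "l \<ge> 1"
  shows "fps_nth (euler_fps oo fps_X ^ (2 * l)) n
       = (\<Sum>m | int l * (m * (3 * m + 1)) = int n. parity_sign m)"
proof (cases "2 * l dvd n")
  case True
  then obtain j where j: "n = 2 * l * j" ..
  have "{m. int l * (m * (3 * m + 1)) = int n} = {m. m * (3 * m + 1) = 2 * int j}"
    using assms by (auto simp: j)
  then show ?thesis
    using assms by (simp add: fps_compose_X_power_nth j) (simp add: euler_fps_def)
next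
  case False
  have "{m. int l * (m * (3 * m + 1)) = int n} = {}"
  proof (intro equals0I, clarify)
    fix m assume "int l * (m * (3 * m + 1)) = int n"
    then have "int n = int (2 * l * pentagonal m)"
      by (simp add: mult.assoc mult.left_commute twice_pentagonal)
    then have "n = 2 * l * pentagonal m"
      by (simp only: of_nat_eq_iff)
    then show False
      using False by simp
  qed
  then show ?thesis
    using False assms by (simp add: fps_compose_X_power_nth)
qed

text \<open>
  The multiplicity of \<open>p\<close> in a square is even, so that $2a - 1$ rounds up to $2a$.
\<close>
lemma prime_power_dvd_square:
  fixes x :: int
  assumes "prime p" and "int p ^ (2 * a - 1) dvd x ^ 2"
  shows "int p ^ a dvd x"
proof (cases "x = 0")
  case False
  have p: "prime (int p)"
    using assms by simp
  then have "2 * a - 1 \<le> multiplicity (int p) (x ^ 2)"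
    using assms(2) False p by (intro multiplicity_geI) auto
  also have "\<dots> = 2 * multiplicity (int p) x"
    using p False by (simp add: prime_elem_multiplicity_power_distrib)
  finally have "a \<le> multiplicity (int p) x"
    by linarith
  then show ?thesis
    by (rule multiplicity_dvd')
qed simp

text \<open>
  The substitution $6m+1 = u(6m'+1)$ preserves the residue 1 modulo 6 exactly when $u \equiv 1$, which
  fixes the sign of $u = \pm p^a$.
\<close>
lemma prime_power_cong_pm_1_mod_6:
  assumes "prime p" "p \<ge> 5"
  obtains u v :: int where "u = 6 * v + 1" "u = int p ^ a \<or> u = - (int p ^ a)"
proof -
  have "\<not> 2 dvd p" "\<not> 3 dvd p"
    using assms primes_dvd_imp_eq[of 2 p] primes_dvd_imp_eq[of 3 p] by auto
  then have "\<not> 2 dvd p ^ a" "\<not> 3 dvd p ^ a"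
    using prime_dvd_power[of 2 p a] prime_dvd_power[of 3 p a] by auto
  then have "p ^ a mod 6 = 1 \<or> p ^ a mod 6 = 5"
    by presburger
  then have "int (p ^ a) mod 6 = 1 \<or> (- int (p ^ a)) mod 6 = 1"
    by presburger
  then show ?thesis
  proof
    assume "int (p ^ a) mod 6 = 1"
    then have "int (p ^ a) = 6 * (int (p ^ a) div 6) + 1"
      by presburger
    then show ?thesis
      using that by simp
  next
    assume "(- int (p ^ a)) mod 6 = 1"
    then have "- int (p ^ a) = 6 * ((- int (p ^ a)) div 6) + 1"
      by presburger
    then show ?thesis
      using that by simp
  qed
qed

text \<open>
  The map $m' \mapsto um' + v$, where $u = 6v + 1 = \pm p^a$, sends $6m' + 1$ to $u(6m'+1)$. It is a
  bijection from the solutions of $k\, m'(3m'+1) + c = n$ to those of $m(3m+1) = n$ whenever \<open>n\<close> lies in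
  the class of \<open>c\<close>, and it multiplies $(-1)^{m'}$ by the constant $(-1)^v$ because \<open>u\<close> is odd.
\<close>
lemma euler_fps_residue_part:
  assumes "prime p" "p \<ge> 5" "a \<ge> 1"
    and r: "r = p ^ (2 * a - 1)" and k: "k = p ^ (2 * a)" and c: "c = (k - 1) div 12"
  obtains e where "fps_residue_part r c (euler_fps oo fps_X ^ 2)
                 = fps_const e * fps_X ^ c * (euler_fps oo fps_X ^ (2 * k))"
proof -
  obtain u v :: int where uv: "u = 6 * v + 1" and u: "u = int p ^ a \<or> u = - (int p ^ a)"
    using prime_power_cong_pm_1_mod_6[OF assms(1,2)] by blast
  have k1: "k \<ge> 1"
    using prime_gt_0_nat[OF assms(1)] k by simp
  have u2: "u ^ 2 = int k"
    using u by (auto simp: k power_mult mult.commute[of 2 a] power2_eq_square)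
  have "int k - 1 = 12 * (v * (3 * v + 1))"
    unfolding u2[symmetric] uv by (simp add: power2_eq_square algebra_simps)
  then have c_eq: "int c = v * (3 * v + 1)"
    using k1 by (simp add: c of_nat_diff zdiv_int)
  have "r dvd k"
    by (simp add: r k le_imp_power_dvd)
  have u0: "u \<noteq> 0"
    using u2 k1 by auto
  define g where "g = (\<lambda>m. u * m + v)"
  have g: "g m * (3 * g m + 1) = int k * (m * (3 * m + 1)) + int c" for m
    unfolding g_def c_eq u2[symmetric] uv by (simp add: power2_eq_square algebra_simps)
  have sign: "parity_sign (g m) = parity_sign v * parity_sign m" for m
    by (auto simp: parity_sign_def g_def uv)

  have "fps_residue_part r c (euler_fps oo fps_X ^ 2)
      = fps_const (parity_sign v) * fps_X ^ c * (euler_fps oo fps_X ^ (2 * k))"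
  proof (rule fps_ext)
    fix n
    let ?S = "{m. int k * (m * (3 * m + 1)) + int c = int n}"
    have rhs: "fps_nth (fps_const (parity_sign v) * fps_X ^ c * (euler_fps oo fps_X ^ (2 * k))) n
        = parity_sign v * (\<Sum>m\<in>?S. parity_sign m)"
    proof (cases "n < c")
      case True
      have "?S = {}"
      proof (intro equals0I, clarify)
        fix m assume m: "int k * (m * (3 * m + 1)) + int c = int n"
        have "m * (3 * m + 1) \<ge> 0"
          unfolding twice_pentagonal[symmetric] by simp
        then have "int k * (m * (3 * m + 1)) \<ge> 0"
          by (rule mult_nonneg_nonneg[OF of_nat_0_le_iff])
        then show False
          using m True by linarith
      qed
      then show ?thesis
        using True by (simp add: mult.assoc fps_X_power_mult_nth)
    next
      case False
      then have "{m. int k * (m * (3 * m + 1)) = int (n - c)} = ?S"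
        by (auto simp: of_nat_diff)
      then show ?thesis
        using False euler_fps_compose_even_nth[OF k1, of "n - c"]
        by (simp add: mult.assoc fps_X_power_mult_nth)
    qed
    have lhs: "fps_nth (euler_fps oo fps_X ^ 2) n = (\<Sum>m | m * (3 * m + 1) = int n. parity_sign m)"
      using euler_fps_compose_even_nth[of 1 n] by simp
    show "fps_nth (fps_residue_part r c (euler_fps oo fps_X ^ 2)) n
        = fps_nth (fps_const (parity_sign v) * fps_X ^ c * (euler_fps oo fps_X ^ (2 * k))) n"
    proof (cases "[n = c] (mod r)")
      case True
      have "{m. m * (3 * m + 1) = int n} = g ` ?S"
      proof (intro equalityI subsetI)
        fix m assume "m \<in> {m. m * (3 * m + 1) = int n}"
        then have m: "m * (3 * m + 1) = int n"
          by simp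
        \<comment> \<open>Surjectivity: $12n + 1 = (6m+1)^2$ and $12c + 1 = k$.\<close>
        have "int r dvd int n - int c"
          using True by (metis cong_iff_dvd_diff cong_int_iff)
        moreover have "(6 * m + 1) ^ 2 = 12 * (int n - int c) + int k"
          unfolding c_eq m[symmetric] u2[symmetric] uv
          by (simp add: power2_eq_square algebra_simps)
        moreover have "int r dvd int k"
          using \<open>r dvd k\<close> by (simp only: of_nat_dvd_iff)
        ultimately have "int r dvd (6 * m + 1) ^ 2"
          by (simp only: dvd_add dvd_mult)
        then have "int p ^ a dvd 6 * m + 1"
          unfolding r of_nat_power by (rule prime_power_dvd_square[OF assms(1)])
        then have "u dvd 6 * m + 1"
          using u by auto
        then obtain t where t: "6 * m + 1 = u * t" ..
        then have "6 * (m - v * t) = t - 1"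
          by (simp add: uv algebra_simps)
        then have "\<exists>s. t = 6 * s + 1"
          by (intro exI[of _ "m - v * t"]) linarith
        then obtain s where s: "t = 6 * s + 1" ..
        have "6 * m + 1 = 6 * g s + 1"
          unfolding t s g_def by (simp add: uv algebra_simps)
        then have "m = g s"
          by simp
        then show "m \<in> g ` ?S"
          using m g[of s] by auto
      qed (auto simp: g)
      moreover have "inj_on g ?S"
        using u0 by (auto simp: g_def inj_on_def)
      ultimately show ?thesis
        unfolding rhs using True
        by (simp add: fps_residue_part_def lhs sum.reindex sign sum_distrib_left)
    next
      case False
      have "?S = {}"
      proof (intro equals0I, clarify)
        fix m assume "int k * (m * (3 * m + 1)) + int c = int n"
        then have "int n - int c = int k * (m * (3 * m + 1))"
          by simp
        then have "int r dvd int n - int c"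
          using \<open>r dvd k\<close> by simp
        then show False
          using False by (metis cong_iff_dvd_diff cong_int_iff)
      qed
      then show ?thesis
        unfolding rhs using False by (simp add: fps_residue_part_def)
    qed
  qed
  then show ?thesis
    by (rule that)
qed

section \<open>The congruence\<close>

text \<open>
  Comparing the terms with exponent in the class of \<open>c\<close> in $B f_{2k} \equiv f_2$ gives
  $B_c f_{2k} \equiv \pm X^c f_{2k}$, where $B_c$ is that part of the generating series.
\<close>
theorem bracelet_partitions_prime_square_power_cong:
  assumes "prime p" "p \<ge> 5" "a \<ge> 1"
    and r: "r = p ^ (2 * a - 1)" and k: "k = p ^ (2 * a)" and c: "c = (k - 1) div 12"
    and n: "[n = c] (mod r)" "n \<noteq> c"
  shows "[bracelet_partitions k n = 0] (mod int p)"
proof -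
  let ?B = "Abs_fps (bracelet_partitions k)" and ?E2k = "euler_fps oo fps_X ^ (2 * k)"
  obtain e where e: "fps_residue_part r c (euler_fps oo fps_X ^ 2) = fps_const e * fps_X ^ c * ?E2k"
    using euler_fps_residue_part[OF assms(1-3) r k c] .
  have k1: "k \<ge> 1"
    using prime_gt_0_nat[OF assms(1)] k by simp
  have "r dvd k"
    by (simp add: r k le_imp_power_dvd)
  have "r dvd i" if "fps_nth ?E2k i \<noteq> 0" for i
    using that k1 \<open>r dvd k\<close> by (auto simp: fps_compose_X_power_nth split: if_splits dest: dvd_mult_right dvd_trans)
  then have "fps_residue_part r c (?B * ?E2k) = fps_residue_part r c ?B * ?E2k"
    by (rule fps_residue_part_mult)
  then have "of_nat p dvd (fps_residue_part r c ?B - fps_const e * fps_X ^ c) * ?E2k"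
    using dvd_fps_residue_part[OF bracelet_fps_cong[OF assms(1) k], of r c] e
    by (simp add: algebra_simps)
  then have "of_nat p dvd fps_residue_part r c ?B - fps_const e * fps_X ^ c"
    by (rule fps_dvd_cancel_unit) (simp add: euler_fps_nth_0)
  then have "int p dvd fps_nth (fps_residue_part r c ?B - fps_const e * fps_X ^ c) n"
    by (simp only: of_nat_dvd_fps_iff)
  then show ?thesis
    using n by (simp add: fps_residue_part_def cong_0_iff)
qed

theorem theorem3p6:
  fixes p \<alpha> k n :: nat
  assumes "prime p" and "p \<ge> 5"
    and "\<alpha> \<ge> 1"
    and "k = p ^ (2 * \<alpha>)"
    and "n \<ge> 1"
  shows "[bracelet_partitions k (p ^ (2 * \<alpha> - 1) * n + (p ^ (2 * \<alpha>) - 1) div 12) = 0] (mod int p)"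
  unfolding assms(4)
proof (rule bracelet_partitions_prime_square_power_cong[OF assms(1-3) refl refl refl])
  show "[p ^ (2 * \<alpha> - 1) * n + (p ^ (2 * \<alpha>) - 1) div 12 = (p ^ (2 * \<alpha>) - 1) div 12]
      (mod p ^ (2 * \<alpha> - 1))"
    by (simp add: cong_def)
  show "p ^ (2 * \<alpha> - 1) * n + (p ^ (2 * \<alpha>) - 1) div 12 \<noteq> (p ^ (2 * \<alpha>) - 1) div 12"
    using assms(5) prime_gt_0_nat[OF assms(1)] by simp
qed

end
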